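(* Let $\mathbb{F}$ be a field of characteristic zero, let $n\ge 2$ be an integer, and let $d\ge 3$ be an odd integer. Let $S=\{P_1,\ldots,P_d\}$ be a set of $d$ generic points in $\mathbf{P}^n$ over $\mathbb{F}$, and let $V(n,d)$ be the $\mathbb{F}$-linear span of the cone polynomials of $S$. Then $$\dim_{\mathbb{F}} V(n,d)\le \binom{d+n}{n}-d-1.$$
   Context: $\mathbf{P}^n$ denotes the projective space of lines through the origin in $\mathbb{F}^{n+1}$. A statement about $d$ generic points $P_1,\ldots,P_d$ of $\mathbf{P}^n$ means: there is a nonempty Zariski-open subset $U\subseteq(\mathbf{P}^n)^d$ (depending on $n,d$) such that the statement holds for all $(P_1,\ldots,P_d)\in U$. Cone polynomials: given $S=\{P_1,\ldots,P_d\}\subset\mathbf{P}^n$, choose an $(n-2)$-plane $\pi$ in $\mathbf{P}^n$ (the projectivization of an $(n-1)$-dimensional linear subspace of $\mathbb{F}^{n+1}$; a point when $n=2$), and for each $1\le i\le d$ choose a linear form $L_i\in\mathbb{F}[x_1,\ldots,x_{n+1}]$ that vanishes at $P_i$ and on $\pi$. The product $\prod_{i=1}^d L_i$ is called a cone polynomial of $S$. The set of cone polynomials consists of all products obtained in this way over all choices of $\pi$ and of the $L_i$. The space $V(n,d)$ is the $\mathbb{F}$-linear span of all cone polynomials of $S$, inside the space of homogeneous polynomials of degree $d$ in $x_1,\ldots,x_{n+1}$. *)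

theory Defs
  imports "HOL-Analysis.Analysis" "HOL-Library.Poly_Mapping"
begin

text \<open>Polynomials over \<open>'a\<close> in variables indexed by \<open>'x\<close>: a finitely supported map from monomials
  (finitely supported exponent vectors) to coefficients, with the convolution product.\<close>

type_synonym ('x, 'a) mpoly = "('x \<Rightarrow>\<^sub>0 nat) \<Rightarrow>\<^sub>0 'a"

definition mpoly_scale :: "'a::field \<Rightarrow> ('x, 'a) mpoly \<Rightarrow> ('x, 'a) mpoly"
  where "mpoly_scale c f = Poly_Mapping.map ((*) c) f"

global_interpretation mpoly: vector_space "mpoly_scale :: 'a::field \<Rightarrow> ('x, 'a) mpoly \<Rightarrow> ('x, 'a) mpoly"
  by unfold_locales
    (simp_all add: mpoly_scale_def mult_map_scale_conv_mult ring_distribs single_add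
      mult_single flip: mult.assoc)

definition mpoly_eval :: "('x, 'a::field) mpoly \<Rightarrow> ('x \<Rightarrow> 'a) \<Rightarrow> 'a"
  where "mpoly_eval f x = (\<Sum>m\<in>Poly_Mapping.keys f. Poly_Mapping.lookup f m *
           (\<Prod>i\<in>Poly_Mapping.keys m. x i ^ Poly_Mapping.lookup m i))"

text \<open>With \<open>k = 1\<close>: the linear forms, including the zero form.\<close>

definition homogeneous :: "nat \<Rightarrow> ('x::finite, 'a::field) mpoly \<Rightarrow> bool"
  where "homogeneous k f \<longleftrightarrow> (\<forall>m\<in>Poly_Mapping.keys f. (\<Sum>i\<in>UNIV. Poly_Mapping.lookup m i) = k)"

text \<open>\<open>'a ^ 'v\<close> plays the role of $F^{n+1}$, where \<open>CARD('v) = n + 1\<close>; a point of $P^n$ is a line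
  through the origin, as a set of vectors (so it contains the zero vector).\<close>

definition projective_space :: "('a::field ^ 'v::finite) set set"
  where "projective_space = {p. vec.subspace p \<and> vec.dim p = 1}"

text \<open>A \<open>d\<close>-tuple of points is a function on an index type \<open>'d\<close> with \<open>CARD('d) = d\<close>.  The variable
  \<open>(i, j)\<close> stands for the \<open>j\<close>-th homogeneous coordinate of the \<open>i\<close>-th point.\<close>

definition tuples :: "('d::finite \<Rightarrow> ('a::field ^ 'v::finite) set) set"
  where "tuples = {P. \<forall>i. P i \<in> projective_space}"

definition multihomogeneous :: "('d::finite \<times> 'v::finite, 'a::field) mpoly \<Rightarrow> bool"
  where "multihomogeneous f \<longleftrightarrow>
    (\<exists>k. \<forall>m\<in>Poly_Mapping.keys f. \<forall>i. (\<Sum>j\<in>UNIV. Poly_Mapping.lookup m (i, j)) = k i)"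

definition vanishes_at ::
    "('d::finite \<times> 'v::finite, 'a::field) mpoly \<Rightarrow> ('d \<Rightarrow> ('a ^ 'v) set) \<Rightarrow> bool"
  where "vanishes_at f P \<longleftrightarrow>
    (\<forall>v. (\<forall>i. v i \<in> P i - {0}) \<longrightarrow> mpoly_eval f (\<lambda>(i, j). v i $ j) = 0)"

definition zariski_closed :: "('d::finite \<Rightarrow> ('a::field ^ 'v::finite) set) set \<Rightarrow> bool"
  where "zariski_closed Z \<longleftrightarrow>
    (\<exists>G. (\<forall>f\<in>G. multihomogeneous f) \<and> Z = {P \<in> tuples. \<forall>f\<in>G. vanishes_at f P})"

definition zariski_open :: "('d::finite \<Rightarrow> ('a::field ^ 'v::finite) set) set \<Rightarrow> bool"
  where "zariski_open U \<longleftrightarrow> U \<subseteq> tuples \<and> zariski_closed (tuples - U)"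

text \<open>\<open>W\<close> is the linear subspace whose projectivization is the chosen $(n-2)$-plane, so its dimension
  is $n - 1$, which is \<open>CARD('v) - 2\<close>.\<close>

definition cone_polynomials ::
    "('d::finite \<Rightarrow> ('a::field ^ 'v::finite) set) \<Rightarrow> ('v, 'a) mpoly set"
  where "cone_polynomials P = {(\<Prod>i\<in>UNIV. L i) | L W.
     vec.subspace W \<and> vec.dim W + 2 = CARD('v) \<and>
     (\<forall>i. homogeneous 1 (L i) \<and> (\<forall>x \<in> P i \<union> W. mpoly_eval (L i) (\<lambda>j. x $ j) = 0))}"

text \<open>This is a subspace of the finite-dimensional space of forms of degree \<open>CARD('d)\<close>, so
  \<open>mpoly.dim\<close> of it is its actual dimension.\<close>

definition cone_space ::
    "('d::finite \<Rightarrow> ('a::field ^ 'v::finite) set) \<Rightarrow> ('v, 'a) mpoly set"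
  where "cone_space P = mpoly.span (cone_polynomials P)"

end

theory Submission
  imports Defs
begin

text \<open>Every cone polynomial vanishes at the \<open>d\<close> points, and it satisfies one more linear condition:
  its polarization at \<open>(P\<^sub>1, \<dots>, P\<^sub>d)\<close> is zero.  Indeed the polarization of \<open>\<Prod> L\<^sub>i\<close> is the permanent of
  \<open>(L\<^sub>i(P\<^sub>j))\<close>.  Projecting from \<open>\<pi>\<close> turns the points into vectors \<open>p\<^sub>i\<close> of a plane and
  \<open>L\<^sub>i(P\<^sub>j)\<close> into \<open>c\<^sub>i det(p\<^sub>i, p\<^sub>j)\<close>, an antisymmetric matrix up to row scaling, whose permanent
  vanishes because \<open>d\<close> is odd.

  For generic points these \<open>d + 1\<close> conditions are independent on the forms of degree \<open>d\<close>: this needs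
  a product of \<open>d\<close> linear forms, the \<open>i\<close>-th one vanishing at \<open>P\<^sub>i\<close>, whose permanent is nonzero.  The
  forms are chosen bilinearly in \<open>P\<^sub>i\<close>, so that the permanent is a polynomial in the points; at
  points of a conic it is the permanent for the tangent lines, which is positive.\<close>

section \<open>Evaluation and grading\<close>

text \<open>Cancellation can make the support of \<open>f + g\<close> smaller than the union of the
  supports; over a common index set evaluation is additive term by term.\<close>

lemma mpoly_eval_superset:
  fixes f :: "('x::finite, 'a::field) mpoly"
  assumes "finite A" "Poly_Mapping.keys f \<subseteq> A"
  shows "mpoly_eval f x = (\<Sum>m\<in>A. Poly_Mapping.lookup f m * (\<Prod>i\<in>UNIV. x i ^ Poly_Mapping.lookup m i))"
proof -
  have "(\<Prod>i\<in>Poly_Mapping.keys m. x i ^ Poly_Mapping.lookup m i) = (\<Prod>i\<in>UNIV. x i ^ Poly_Mapping.lookup m i)"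
    for m :: "'x \<Rightarrow>\<^sub>0 nat"
    by (rule prod.mono_neutral_left) (auto simp: in_keys_iff)
  then show ?thesis
    unfolding mpoly_eval_def
    by (simp, intro sum.mono_neutral_left) (use assms in \<open>auto simp: in_keys_iff\<close>)
qed

lemma mpoly_eval_eq:
  fixes f :: "('x::finite, 'a::field) mpoly"
  shows "mpoly_eval f x =
    (\<Sum>m\<in>Poly_Mapping.keys f. Poly_Mapping.lookup f m * (\<Prod>i\<in>UNIV. x i ^ Poly_Mapping.lookup m i))"
  by (rule mpoly_eval_superset) auto

lemma mpoly_eval_zero [simp]: "mpoly_eval 0 x = 0"
  by (simp add: mpoly_eval_def)

lemma mpoly_eval_add:
  fixes f g :: "('x::finite, 'a::field) mpoly"
  shows "mpoly_eval (f + g) x = mpoly_eval f x + mpoly_eval g x"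
proof -
  let ?A = "Poly_Mapping.keys f \<union> Poly_Mapping.keys g"
  note sup = mpoly_eval_superset[where A = ?A and x = x]
  have "Poly_Mapping.keys (f + g) \<subseteq> ?A"
    by (rule keys_add)
  then show ?thesis
    by (simp add: sup lookup_add ring_distribs sum.distrib)
qed

lemma mpoly_eval_single:
  fixes m :: "'x::finite \<Rightarrow>\<^sub>0 nat"
  shows "mpoly_eval (Poly_Mapping.single m c) x = c * (\<Prod>i\<in>UNIV. x i ^ Poly_Mapping.lookup m i)"
  by (simp add: mpoly_eval_superset[where A = "{m}"])

lemma poly_mapping_sum_single:
  fixes f :: "'k \<Rightarrow>\<^sub>0 'a::comm_monoid_add"
  shows "f = (\<Sum>m\<in>Poly_Mapping.keys f. Poly_Mapping.single m (Poly_Mapping.lookup f m))"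
  by (rule poly_mapping_eqI) (auto simp: lookup_sum lookup_single when_def in_keys_iff)

lemma mpoly_eval_sum:
  fixes f :: "'k \<Rightarrow> ('x::finite, 'a::field) mpoly"
  shows "mpoly_eval (\<Sum>k\<in>K. f k) x = (\<Sum>k\<in>K. mpoly_eval (f k) x)"
  by (induction K rule: infinite_finite_induct) (auto simp: mpoly_eval_add)

lemma mpoly_eval_mult:
  fixes f g :: "('x::finite, 'a::field) mpoly"
  shows "mpoly_eval (f * g) x = mpoly_eval f x * mpoly_eval g x"
proof -
  have "f * g = (\<Sum>m\<in>Poly_Mapping.keys f. \<Sum>m'\<in>Poly_Mapping.keys g.
      Poly_Mapping.single (m + m') (Poly_Mapping.lookup f m * Poly_Mapping.lookup g m'))"
    by (subst (1) poly_mapping_sum_single[of f], subst (1) poly_mapping_sum_single[of g])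
      (simp add: sum_product mult_single)
  then show ?thesis
    by (simp add: mpoly_eval_sum mpoly_eval_single lookup_add power_add prod.distrib
        mpoly_eval_eq[of f] mpoly_eval_eq[of g] sum_product mult_ac)
qed

lemma mpoly_eval_one [simp]:
  fixes x :: "'x::finite \<Rightarrow> 'a::field"
  shows "mpoly_eval 1 x = 1"
  using mpoly_eval_single[of 0 1 x] by (simp del: single_one add: single_one[symmetric])

lemma mpoly_eval_prod:
  fixes f :: "'k \<Rightarrow> ('x::finite, 'a::field) mpoly"
  shows "mpoly_eval (\<Prod>k\<in>K. f k) x = (\<Prod>k\<in>K. mpoly_eval (f k) x)"
  by (induction K rule: infinite_finite_induct) (auto simp: mpoly_eval_mult)

lemma mpoly_eval_scale:
  fixes f :: "('x::finite, 'a::field) mpoly"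
  shows "mpoly_eval (mpoly_scale c f) x = c * mpoly_eval f x"
  by (simp add: mpoly_scale_def mult_map_scale_conv_mult mpoly_eval_mult mpoly_eval_single)

text \<open>One notion for two uses: \<open>X = UNIV\<close> gives homogeneity, and
  \<open>X = {i} \<times> UNIV\<close> gives the degree in the coordinates of the
  \<open>i\<close>-th point.\<close>

definition graded :: "'x set \<Rightarrow> nat \<Rightarrow> ('x, 'a::field) mpoly \<Rightarrow> bool"
  where "graded X k f \<longleftrightarrow> (\<forall>m\<in>Poly_Mapping.keys f. (\<Sum>i\<in>X. Poly_Mapping.lookup m i) = k)"

lemma homogeneous_iff_graded: "homogeneous k f \<longleftrightarrow> graded UNIV k f"
  by (simp add: homogeneous_def graded_def)

lemma graded_zero: "graded X k 0"
  by (simp add: graded_def)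

lemma graded_single:
  "(\<Sum>i\<in>X. Poly_Mapping.lookup m i) = k \<Longrightarrow> graded X k (Poly_Mapping.single m c)"
  by (simp add: graded_def)

lemma graded_one: "graded X 0 1"
  by (simp add: graded_def)

lemma graded_add: "graded X k f \<Longrightarrow> graded X k g \<Longrightarrow> graded X k (f + g)"
  using keys_add[of f g] by (fastforce simp: graded_def)

lemma graded_mult: "graded X k f \<Longrightarrow> graded X l g \<Longrightarrow> graded X (k + l) (f * g)"
  using keys_mult[of f g] by (fastforce simp: graded_def lookup_add sum.distrib)

lemma graded_sum: "(\<And>i. i \<in> K \<Longrightarrow> graded X k (f i)) \<Longrightarrow> graded X k (\<Sum>i\<in>K. f i)"
  by (induction K rule: infinite_finite_induct) (auto simp: graded_zero graded_add)

lemma graded_prod: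
  "(\<And>i. i \<in> K \<Longrightarrow> graded X (k i) (f i)) \<Longrightarrow> graded X (\<Sum>i\<in>K. k i) (\<Prod>i\<in>K. f i)"
  by (induction K rule: infinite_finite_induct) (auto simp: graded_one graded_mult)

lemma graded_scale: "graded X k f \<Longrightarrow> graded X k (mpoly_scale c f)"
  using graded_mult[OF graded_single[where m = 0 and k = 0], of X k f c]
  by (simp add: mpoly_scale_def mult_map_scale_conv_mult)

section \<open>Forms\<close>

lemma homogeneous_subspace: "mpoly.subspace {f :: ('x::finite, 'a::field) mpoly. homogeneous k f}"
  by (auto simp: mpoly.subspace_def homogeneous_iff_graded graded_zero graded_add graded_scale)

definition form_monomials :: "nat \<Rightarrow> ('x::finite \<Rightarrow>\<^sub>0 nat) set"
  where "form_monomials k = {m. (\<Sum>i\<in>UNIV. Poly_Mapping.lookup m i) = k}"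

text \<open>Exponent vectors of total degree \<open>k\<close> correspond to multisets of
  \<open>k\<close> variables, which stars and bars counts.\<close>

lemma form_monomials_card:
  "finite (form_monomials k :: ('x::finite \<Rightarrow>\<^sub>0 nat) set)"
  "card (form_monomials k :: ('x \<Rightarrow>\<^sub>0 nat) set) = (CARD('x) + k - 1) choose k"
proof -
  let ?M = "multisets_of_size (UNIV :: 'x set) k"
  have sz: "size X = (\<Sum>i\<in>UNIV. count X i)" for X :: "'x multiset"
    unfolding size_multiset_overloaded_eq
    by (rule sum.mono_neutral_left) (auto simp: not_in_iff)
  have bij: "bij_betw (\<lambda>X. Abs_poly_mapping (count X)) ?M (form_monomials k)"
    by (rule bij_betw_byWitness[where f' = "\<lambda>m. Abs_multiset (Poly_Mapping.lookup m)"])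
      (auto simp: multisets_of_size_def form_monomials_def sz Abs_poly_mapping_inverse
        Abs_multiset_inverse count_inverse lookup_inverse)
  show "finite (form_monomials k :: ('x::finite \<Rightarrow>\<^sub>0 nat) set)"
    using bij_betw_finite[OF bij] finite_multisets_of_size[of "UNIV :: 'x set" k] by simp
  show "card (form_monomials k :: ('x \<Rightarrow>\<^sub>0 nat) set) = (CARD('x) + k - 1) choose k"
    using bij_betw_same_card[OF bij] card_multisets_of_size[of "UNIV :: 'x set" k] by simp
qed

text \<open>The polynomial ring is infinite-dimensional, so dimensions are compared inside the span
  of a finite set; the monomials of degree \<open>k\<close> form one of the right size.\<close>

lemma homogeneous_dim:
  "\<exists>B :: ('x::finite, 'a::field) mpoly set. finite B \<and> card B \<le> (CARD('x) + k - 1) choose k \<and>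
    {f. homogeneous k f} \<subseteq> mpoly.span B"
proof (intro exI conjI subsetI)
  let ?M = "form_monomials k :: ('x \<Rightarrow>\<^sub>0 nat) set"
  let ?B = "(\<lambda>m. Poly_Mapping.single m 1) ` ?M :: ('x, 'a) mpoly set"
  show "finite ?B"
    by (simp add: form_monomials_card)
  show "card ?B \<le> (CARD('x) + k - 1) choose k"
    using card_image_le[of ?M "\<lambda>m. Poly_Mapping.single m 1"] form_monomials_card[of k, where 'x = 'x]
    by metis
  fix f :: "('x, 'a) mpoly" assume "f \<in> {f. homogeneous k f}"
  then have f: "Poly_Mapping.keys f \<subseteq> ?M"
    by (auto simp: homogeneous_def form_monomials_def)
  have "Poly_Mapping.single m (Poly_Mapping.lookup f m) \<in> mpoly.span ?B"
    if "m \<in> Poly_Mapping.keys f" for m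
  proof -
    have "mpoly_scale (Poly_Mapping.lookup f m) (Poly_Mapping.single m 1) \<in> mpoly.span ?B"
      using f that by (intro mpoly.span_scale mpoly.span_base) auto
    then show ?thesis
      by (simp add: mpoly_scale_def mult_map_scale_conv_mult mult_single)
  qed
  then show "f \<in> mpoly.span ?B"
    by (subst poly_mapping_sum_single) (rule mpoly.span_sum)
qed

section \<open>Linear forms and their values\<close>

lemma homogeneous_1_eval:
  fixes L :: "('x::finite, 'a::field) mpoly"
  assumes "homogeneous 1 L"
  obtains c where "\<And>x. mpoly_eval L x = (\<Sum>j\<in>UNIV. c j * x j)"
proof -
  \<comment> \<open>An exponent vector with sum 1 has a single entry 1, so its monomial is one
    variable.\<close>
  have "\<exists>j. \<forall>x. (\<Prod>i\<in>UNIV. x i ^ Poly_Mapping.lookup m i) = (x j :: 'a)"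
    if m: "m \<in> Poly_Mapping.keys L" for m
  proof -
    have "(\<Sum>i\<in>UNIV. Poly_Mapping.lookup m i) = 1"
      using assms m by (simp add: homogeneous_def)
    then obtain j where j: "Poly_Mapping.lookup m j = 1" "\<And>i. i \<noteq> j \<Longrightarrow> Poly_Mapping.lookup m i = 0"
      by (auto simp: sum_eq_Suc0_iff)
    have "x i ^ Poly_Mapping.lookup m i = (if i = j then x j else 1)" for x :: "'x \<Rightarrow> 'a" and i
      using j by auto
    then show ?thesis by auto
  qed
  then obtain J where J: "\<And>m x. m \<in> Poly_Mapping.keys L \<Longrightarrow>
      (\<Prod>i\<in>UNIV. x i ^ Poly_Mapping.lookup m i) = (x (J m) :: 'a)"
    by metis
  \<comment> \<open>The coefficients of all monomials with variable \<open>j\<close> are added, so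
    injectivity of \<open>J\<close> does not come up.\<close>
  define c where "c j = (\<Sum>m\<in>Poly_Mapping.keys L. if J m = j then Poly_Mapping.lookup L m else 0)" for j
  have "mpoly_eval L x = (\<Sum>j\<in>UNIV. c j * x j)" for x
  proof -
    have "mpoly_eval L x = (\<Sum>m\<in>Poly_Mapping.keys L. Poly_Mapping.lookup L m * x (J m))"
      by (simp add: mpoly_eval_eq J)
    also have "\<dots> = (\<Sum>m\<in>Poly_Mapping.keys L. \<Sum>j\<in>UNIV.
        (if J m = j then Poly_Mapping.lookup L m else 0) * x j)"
      by (simp add: if_distrib[of "\<lambda>t. t * _"] cong: if_cong)
    also have "\<dots> = (\<Sum>j\<in>UNIV. c j * x j)"
      by (subst sum.swap) (simp add: c_def sum_distrib_right)
    finally show ?thesis .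
  qed
  then show thesis by (rule that)
qed

definition linear_form :: "('x \<Rightarrow> 'a) \<Rightarrow> ('x::finite, 'a::field) mpoly"
  where "linear_form c = (\<Sum>j\<in>UNIV. Poly_Mapping.single (Poly_Mapping.single j 1) (c j))"

lemma mpoly_eval_var:
  "mpoly_eval (Poly_Mapping.single (Poly_Mapping.single j 1) c) x = c * (x j :: 'a::field)"
  for j :: "'x::finite"
proof -
  have "x i ^ Poly_Mapping.lookup (Poly_Mapping.single j 1) i = (if i = j then x j else 1)" for i
    by (auto simp: lookup_single)
  then show ?thesis
    by (simp add: mpoly_eval_single)
qed

lemma mpoly_eval_linear_form: "mpoly_eval (linear_form c) x = (\<Sum>j\<in>UNIV. c j * x j)"
  by (simp add: linear_form_def mpoly_eval_sum mpoly_eval_var del: One_nat_def)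

lemma homogeneous_linear_form: "homogeneous 1 (linear_form c)"
  unfolding homogeneous_iff_graded linear_form_def
  by (intro graded_sum graded_single) (simp add: lookup_single when_def)

section \<open>Linear conditions\<close>

context vector_space
begin

text \<open>A basis of the kernel stays independent when \<open>w\<close> is added, and the result
  still lies in \<open>T\<close>. The finite set \<open>B\<close> keeps the bases finite.\<close>

lemma dim_kernel_less:
  assumes T: "subspace T" and B: "finite B" "T \<subseteq> span B"
    and lin: "\<And>f g. \<phi> (f + g) = \<phi> f + \<phi> g" "\<And>c f. \<phi> (scale c f) = c * \<phi> f"
    and w: "w \<in> T" "\<phi> w \<noteq> 0"
  shows "dim {f \<in> T. \<phi> f = 0} + 1 \<le> dim T"
proof -
  let ?K = "{f \<in> T. \<phi> f = 0}"
  have "\<phi> 0 = 0"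
    using lin(2)[of 0 0] by simp
  then have K: "subspace ?K"
    using T unfolding subspace_def by (simp add: lin)
  obtain A where A: "A \<subseteq> ?K" "independent A" "?K \<subseteq> span A" "card A = dim ?K"
    by (rule basis_exists)
  obtain C where C: "C \<subseteq> T" "independent C" "T \<subseteq> span C" "card C = dim T"
    by (rule basis_exists)
  have "finite C"
    using independent_span_bound[OF B(1) C(2) subset_trans[OF C(1) B(2)]] by simp
  have "w \<notin> span A"
    using w(2) span_minimal[OF A(1) K] by blast
  then have "independent (insert w A)"
    using A(2) by (rule independent_insertI)
  moreover have "insert w A \<subseteq> span C"
    using A(1) w(1) C(3) by blast
  ultimately have "finite (insert w A) \<and> card (insert w A) \<le> card C"
    by (rule independent_span_bound[OF \<open>finite C\<close>])
  moreover have "w \<notin> A"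
    using \<open>w \<notin> span A\<close> span_base[of w A] by blast
  ultimately show ?thesis
    unfolding A(4)[symmetric] C(4)[symmetric] by (auto simp: card_insert_disjoint)
qed

text \<open>The \<open>w i\<close> are dual to the functionals up to scaling: each lies in the
  kernel of all the others, so imposing the conditions one at a time lowers the dimension at every
  step.\<close>

lemma dim_common_kernel:
  assumes T: "subspace T" and B: "finite B" "T \<subseteq> span B" and I: "finite I"
    and lin: "\<And>i f g. \<phi> i (f + g) = \<phi> i f + \<phi> i g" "\<And>i c f. \<phi> i (scale c f) = c * \<phi> i f"
    and w: "\<And>i. i \<in> I \<Longrightarrow> w i \<in> T" "\<And>i. i \<in> I \<Longrightarrow> \<phi> i (w i) \<noteq> 0"
      "\<And>i j. i \<in> I \<Longrightarrow> j \<in> I \<Longrightarrow> i \<noteq> j \<Longrightarrow> \<phi> j (w i) = 0"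
  shows "dim {f \<in> T. \<forall>i\<in>I. \<phi> i f = 0} + card I \<le> dim T"
  using I w
proof (induction I rule: finite_induct)
  case empty
  then show ?case by simp
next
  case (insert i I)
  let ?K = "{f \<in> T. \<forall>i\<in>I. \<phi> i f = 0}"
  have z: "\<phi> j 0 = 0" for j
    using lin(2)[of j 0 0] by simp
  have "subspace ?K"
    using T unfolding subspace_def by (simp add: lin z)
  moreover have "w i \<in> ?K"
    using insert.prems(1,3) insert.hyps(2) by (simp, metis)
  ultimately have "dim {f \<in> ?K. \<phi> i f = 0} + 1 \<le> dim ?K"
    using B insert.prems(2) by (intro dim_kernel_less[where w = "w i" and B = B]) (simp_all add: lin subset_iff)
  moreover have K: "{f \<in> ?K. \<phi> i f = 0} = {f \<in> T. \<forall>i\<in>insert i I. \<phi> i f = 0}"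
    by blast
  moreover have "dim ?K + card I \<le> dim T"
    using insert.prems by (intro insert.IH) simp_all
  ultimately show ?case
    unfolding card_insert_disjoint[OF insert.hyps] K by linarith
qed

end

section \<open>Permanents and polarization\<close>

definition permanent :: "('d::finite \<Rightarrow> 'd \<Rightarrow> 'a::comm_ring_1) \<Rightarrow> 'a"
  where "permanent M = (\<Sum>p | bij p. \<Prod>i\<in>UNIV. M i (p i))"

text \<open>Replace each permutation by its inverse, then reorder each product along the
  permutation.\<close>

lemma permanent_transpose:
  fixes M :: "'d::finite \<Rightarrow> 'd \<Rightarrow> 'a::comm_ring_1"
  shows "permanent (\<lambda>i j. M j i) = permanent M"
proof -
  have "permanent M = (\<Sum>p | bij p. \<Prod>i\<in>UNIV. M i (inv p i))"
    unfolding permanent_def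
    by (rule sum.reindex_bij_witness[where i = inv and j = inv])
      (auto simp: inv_inv_eq bij_imp_bij_inv)
  also have "\<dots> = permanent (\<lambda>i j. M j i)"
    unfolding permanent_def
  proof (rule sum.cong)
    fix p :: "'d \<Rightarrow> 'd" assume "p \<in> {p. bij p}"
    then have p: "bij p" by simp
    show "(\<Prod>i\<in>UNIV. M i (inv p i)) = (\<Prod>i\<in>UNIV. M (p i) i)"
      using prod.reindex_bij_betw[OF p, of "\<lambda>i. M i (inv p i)"]
      by (simp add: inv_f_f[OF bij_is_inj[OF p]])
  qed simp
  finally show ?thesis by simp
qed

lemma permanent_row_scale: "permanent (\<lambda>i j. c i * M i j) = (\<Prod>i\<in>UNIV. c i) * permanent M"
  by (simp add: permanent_def prod.distrib sum_distrib_left)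

lemma permanent_zero_column:
  fixes M :: "'d::finite \<Rightarrow> 'd \<Rightarrow> 'a::comm_ring_1"
  assumes "\<And>i. M i k = 0"
  shows "permanent M = 0"
  unfolding permanent_def
proof (rule sum.neutral, safe)
  fix p :: "'d \<Rightarrow> 'd" assume "bij p"
  then obtain i where "p i = k"
    by (metis bij_is_surj surjD)
  then have "M i (p i) = 0"
    using assms by simp
  then show "(\<Prod>i\<in>UNIV. M i (p i)) = 0"
    using prod_zero[of UNIV "\<lambda>i. M i (p i)"] by auto
qed

text \<open>Transposition preserves the permanent but here negates an odd number of rows, so the
  permanent equals its negative; characteristic zero allows division by 2.\<close>

lemma permanent_antisymmetric_odd:
  fixes M :: "'d::finite \<Rightarrow> 'd \<Rightarrow> 'a::field_char_0"
  assumes "odd CARD('d)" and anti: "\<And>i j. M j i = - M i j"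
  shows "permanent M = 0"
proof -
  have "permanent M = permanent (\<lambda>i j. M j i)"
    by (rule permanent_transpose[symmetric])
  also have "\<dots> = permanent (\<lambda>i j. (- 1) * M i j)"
    by (subst anti) simp
  also have "\<dots> = - permanent M"
    unfolding permanent_row_scale using assms(1) by simp
  finally have "permanent M + permanent M = 0"
    by (simp only: eq_neg_iff_add_eq_0)
  then have "2 * permanent M = 0"
    by (simp only: mult_2)
  then show ?thesis
    by simp
qed

text \<open>Ryser's formula. Expanding the product yields all maps with range inside
  \<open>T\<close>; Moebius inversion over subsets leaves the surjective maps.\<close>

lemma permanent_inclusion_exclusion:
  fixes M :: "'d::finite \<Rightarrow> 'd \<Rightarrow> 'a::comm_ring_1"
  shows "(\<Sum>T\<in>UNIV. (-1) ^ (CARD('d) - card T) * (\<Prod>i\<in>UNIV. \<Sum>j\<in>T. M i j)) = permanent M"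
proof -
  define F where "F T = (\<Sum>s | range s = T. \<Prod>i\<in>UNIV. M i (s i))" for T
  have "(\<Prod>i\<in>UNIV. \<Sum>j\<in>T. M i j) = sum F (Pow T)" for T
  proof -
    have "(\<Prod>i\<in>UNIV. \<Sum>j\<in>T. M i j) = (\<Sum>s | range s \<subseteq> T. \<Prod>i\<in>UNIV. M i (s i))"
      by (subst prod_sum_PiE) (auto intro!: sum.cong simp: PiE_UNIV_domain)
    also have "\<dots> = (\<Sum>R\<in>Pow T. \<Sum>s | s \<in> {s. range s \<subseteq> T} \<and> range s = R. \<Prod>i\<in>UNIV. M i (s i))"
      by (rule sum.group[symmetric]) auto
    also have "\<dots> = sum F (Pow T)"
      unfolding F_def by (rule sum.cong[OF refl], rule sum.cong) auto
    finally show ?thesis .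
  qed
  then have "F UNIV = (\<Sum>T\<in>Pow UNIV. (-1) ^ (CARD('d) - card T) * (\<Prod>i\<in>UNIV. \<Sum>j\<in>T. M i j))"
    by (intro inclusion_exclusion_mobius) auto
  \<comment> \<open>A surjective map of a finite type to itself is a bijection.\<close>
  moreover have "F UNIV = permanent M"
    unfolding F_def permanent_def
    by (rule sum.cong) (auto simp: bij_def finite_UNIV_surj_inj)
  ultimately show ?thesis by simp
qed

text \<open>Up to the factor \<open>d!\<close>, this is the symmetric multilinear form of a form of degree \<open>d\<close>, evaluated
  at \<open>v\<close>; it is written as a combination of values of the form by inclusion-exclusion.\<close>

definition polarization :: "('d::finite \<Rightarrow> 'a ^ 'v) \<Rightarrow> ('v::finite, 'a::field) mpoly \<Rightarrow> 'a"
  where "polarization v f =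
    (\<Sum>T\<in>UNIV. (-1) ^ (CARD('d) - card T) * mpoly_eval f (\<lambda>j. (\<Sum>i\<in>T. v i) $ j))"

lemma polarization_add: "polarization v (f + g) = polarization v f + polarization v g"
  by (simp add: polarization_def mpoly_eval_add ring_distribs sum.distrib)

lemma polarization_scale: "polarization v (mpoly_scale c f) = c * polarization v f"
  by (simp add: polarization_def mpoly_eval_scale sum_distrib_left mult_ac)

lemma homogeneous_1_eval_sum:
  assumes "homogeneous 1 L"
  shows "mpoly_eval L (\<lambda>j. (\<Sum>i\<in>T. v i) $ j) = (\<Sum>i\<in>T. mpoly_eval L (\<lambda>j. v i $ j))"
proof -
  obtain l where l: "\<And>x. mpoly_eval L x = (\<Sum>j\<in>UNIV. l j * x j)"
    using homogeneous_1_eval[OF assms] by blast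
  show ?thesis
    by (simp add: l sum_distrib_left) (rule sum.swap)
qed

text \<open>Each factor is additive, so its values at the partial sums of the \<open>v i\<close> are
  the partial row sums in Ryser's formula.\<close>

lemma polarization_prod_linear:
  fixes v :: "'d::finite \<Rightarrow> 'a::field ^ 'v::finite"
  assumes "\<And>i. homogeneous 1 (L i)"
  shows "polarization v (\<Prod>i\<in>UNIV. L i) = permanent (\<lambda>i j. mpoly_eval (L i) (\<lambda>k. v j $ k))"
proof -
  have "mpoly_eval (L i) (\<lambda>j. (\<Sum>i\<in>T. v i) $ j) = (\<Sum>j\<in>T. mpoly_eval (L i) (\<lambda>k. v j $ k))" for i T
    using homogeneous_1_eval_sum[OF assms] .
  then show ?thesis
    unfolding polarization_def mpoly_eval_prod permanent_inclusion_exclusion[symmetric]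
    by (simp del: sum_component)
qed

section \<open>Cone polynomials\<close>

text \<open>The zero diagonal makes \<open>(a i, b i)\<close> orthogonal to
  \<open>(\<alpha> i, \<beta> i)\<close>, hence a multiple of
  \<open>(- \<beta> i, \<alpha> i)\<close> if the latter is nonzero. Then \<open>M\<close> is a row
  scaling of the antisymmetric matrix of 2 by 2 determinants.\<close>

lemma permanent_rank_two:
  fixes M :: "'d::finite \<Rightarrow> 'd \<Rightarrow> 'a::field_char_0"
  assumes "odd CARD('d)"
    and M: "\<And>i j. M i j = \<alpha> j * a i + \<beta> j * b i" and diag: "\<And>i. M i i = 0"
  shows "permanent M = 0"
proof (cases "\<exists>k. \<alpha> k = 0 \<and> \<beta> k = 0")
  \<comment> \<open>A zero vector \<open>(\<alpha> k, \<beta> k)\<close>, as for a point on the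
    center of projection, gives a zero column.\<close>
  case True
  then obtain k where "\<alpha> k = 0" "\<beta> k = 0"
    by blast
  then have "M i k = 0" for i
    by (simp add: M)
  then show ?thesis
    by (rule permanent_zero_column)
next
  case False
  have "\<exists>c. a i = - c * \<beta> i \<and> b i = c * \<alpha> i" for i
  proof (cases "\<alpha> i = 0")
    case True
    then have "\<beta> i \<noteq> 0" "b i = 0"
      using False M[of i i] diag[of i] by auto
    then show ?thesis
      using True by (intro exI[of _ "- a i / \<beta> i"]) simp
  next
    case False
    then show ?thesis
      using M[of i i] diag[of i]
      by (intro exI[of _ "b i / \<alpha> i"]) (simp add: field_simps eq_neg_iff_add_eq_0)
  qed
  then obtain c where c: "\<And>i. a i = - c i * \<beta> i" "\<And>i. b i = c i * \<alpha> i"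
    by metis
  have "M = (\<lambda>i j. c i * (\<alpha> i * \<beta> j - \<beta> i * \<alpha> j))"
    by (intro ext) (simp add: M c algebra_simps)
  moreover have "permanent (\<lambda>i j. \<alpha> i * \<beta> j - \<beta> i * \<alpha> j) = 0"
    using assms(1) by (rule permanent_antisymmetric_odd) (simp add: algebra_simps)
  ultimately show ?thesis
    by (simp add: permanent_row_scale)
qed

text \<open>Extending a basis of \<open>W\<close> to the whole space adds exactly two vectors;
  \<open>\<alpha>\<close> and \<open>\<beta>\<close> are the coordinates of the projection from
  \<open>W\<close> to a plane.\<close>

lemma codimension_two:
  fixes W :: "('a::field ^ 'v::finite) set"
  assumes W: "vec.subspace W" and dim: "vec.dim W + 2 = CARD('v)"
  obtains u u' where "\<And>x. \<exists>\<alpha> \<beta>. x - \<alpha> *s u - \<beta> *s u' \<in> W"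
proof -
  obtain A where A: "A \<subseteq> W" "vec.independent A" "W \<subseteq> vec.span A" "card A = vec.dim W"
    by (rule vec.basis_exists)
  obtain C where C: "A \<subseteq> C" "vec.independent C" "UNIV \<subseteq> vec.span C"
    by (rule vec.maximal_independent_subset_extend[OF subset_UNIV A(2)])
  have "finite C"
    using C(2) by (rule vec.finiteI_independent)
  have "card C = CARD('v)"
    using vec.basis_card_eq_dim[OF subset_UNIV C(3,2)] by (simp only: vec_dim_card)
  then have "card (C - A) = 2"
    using dim A(4) C(1) \<open>finite C\<close> by (simp add: card_Diff_subset finite_subset)
  then obtain u u' where u: "C - A = {u, u'}"
    by (auto simp: card_2_iff)
  then have C_eq: "C = insert u (insert u' A)"
    using C(1) by blast
  have "\<exists>\<alpha> \<beta>. x - \<alpha> *s u - \<beta> *s u' \<in> W" for x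
  proof -
    have "x \<in> vec.span (insert u (insert u' A))"
      using C(3) C_eq by auto
    then obtain \<alpha> \<beta> where "x - \<alpha> *s u - \<beta> *s u' \<in> vec.span A"
      by (auto simp: vec.span_breakdown_eq)
    then show ?thesis
      using vec.span_minimal[OF A(1) W] by blast
  qed
  then show thesis by (rule that)
qed

text \<open>The \<open>i\<close>-th factor vanishes at \<open>v i\<close>, which gives the second
  claim. For the third, every factor vanishes on \<open>W\<close> and so depends only on the two
  projected coordinates; this puts the matrix of values into the shape of
  \<open>permanent_rank_two\<close>.\<close>

lemma cone_polynomial_conditions:
  fixes P :: "'d::finite \<Rightarrow> ('a::field_char_0 ^ 'v::finite) set"
  assumes "odd CARD('d)" and v: "\<And>i. v i \<in> P i" and f: "f \<in> cone_polynomials P"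
  shows "homogeneous CARD('d) f"
    and "mpoly_eval f (\<lambda>k. v i $ k) = 0"
    and "polarization v f = 0"
proof -
  obtain L W where L: "f = (\<Prod>i\<in>UNIV. L i)" and W: "vec.subspace W" "vec.dim W + 2 = CARD('v)"
    and hom: "\<And>i. homogeneous 1 (L i)"
    and van: "\<And>i x. x \<in> P i \<union> W \<Longrightarrow> mpoly_eval (L i) (\<lambda>j. x $ j) = 0"
    using f unfolding cone_polynomials_def by blast
  show "homogeneous CARD('d) f"
    using graded_prod[of UNIV UNIV "\<lambda>_. 1" L] hom by (simp add: L homogeneous_iff_graded)
  have "mpoly_eval (L i) (\<lambda>k. v i $ k) = 0"
    using van[of "v i" i] v by simp
  then show "mpoly_eval f (\<lambda>k. v i $ k) = 0"
    unfolding L mpoly_eval_prod by (intro prod_zero) auto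
  obtain u u' where "\<And>x. \<exists>\<alpha> \<beta>. x - \<alpha> *s u - \<beta> *s u' \<in> W"
    using codimension_two[OF W] by blast
  \<comment> \<open>Any choice of coordinates serves: \<open>split\<close> follows because
    \<open>L i\<close> kills the remainder in \<open>W\<close>.\<close>
  then obtain \<alpha> \<beta> where ab: "\<And>x. x - \<alpha> x *s u - \<beta> x *s u' \<in> W"
    by metis
  have split: "mpoly_eval (L i) (\<lambda>k. x $ k) =
      \<alpha> x * mpoly_eval (L i) (\<lambda>k. u $ k) + \<beta> x * mpoly_eval (L i) (\<lambda>k. u' $ k)" for i x
  proof -
    obtain l where l: "\<And>x. mpoly_eval (L i) x = (\<Sum>j\<in>UNIV. l j * x j)"
      using homogeneous_1_eval[OF hom] by blast
    have "mpoly_eval (L i) (\<lambda>k. (x - \<alpha> x *s u - \<beta> x *s u') $ k) = 0"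
      using van[of "x - \<alpha> x *s u - \<beta> x *s u'" i] ab by blast
    then show ?thesis
      by (simp add: l sum_distrib_left sum.distrib sum_subtractf algebra_simps)
  qed
  have "permanent (\<lambda>i j. mpoly_eval (L i) (\<lambda>k. v j $ k)) = 0"
  proof (rule permanent_rank_two[OF assms(1)])
    show "mpoly_eval (L i) (\<lambda>k. v j $ k) = \<alpha> (v j) * mpoly_eval (L i) (\<lambda>k. u $ k) +
        \<beta> (v j) * mpoly_eval (L i) (\<lambda>k. u' $ k)" for i j
      by (rule split)
    show "mpoly_eval (L i) (\<lambda>k. v i $ k) = 0" for i
      using van[of "v i" i] v by simp
  qed
  then show "polarization v f = 0"
    unfolding L polarization_prod_linear[OF hom] .
qed

section \<open>Independence of the conditions\<close>

text \<open>A Pluecker coordinate of the pair \<open>p\<close>, \<open>q\<close>. As a function of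
  \<open>q\<close> it is a linear form vanishing at \<open>p\<close>, with coefficients linear in
  \<open>p\<close>.\<close>

definition wedge :: "'v \<Rightarrow> 'v \<Rightarrow> ('v \<Rightarrow> 'a::field) \<Rightarrow> ('v \<Rightarrow> 'a) \<Rightarrow> 'a"
  where "wedge a b p q = p a * q b - p b * q a"

text \<open>If \<open>p = (1, s, s\<^sup>2)\<close> in the coordinates \<open>a, b, c\<close>, this is the equation of the tangent line
  at \<open>p\<close> of the conic \<open>(1, t, t\<^sup>2)\<close>; the definition makes it antisymmetric for all \<open>p\<close>.\<close>

definition tangent :: "'v \<Rightarrow> 'v \<Rightarrow> 'v \<Rightarrow> 'a \<Rightarrow> ('v \<Rightarrow> 'a::field) \<Rightarrow> ('v \<Rightarrow> 'a) \<Rightarrow> 'a"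
  where "tangent a b c s p q = wedge a c p q - 2 * s * wedge a b p q"

definition wedge_form :: "'v \<Rightarrow> 'v \<Rightarrow> ('v \<Rightarrow> 'a::field) \<Rightarrow> ('v::finite, 'a) mpoly"
  where "wedge_form a b p = linear_form (\<lambda>j. p a * of_bool (j = b) - p b * of_bool (j = a))"

definition tangent_form :: "'v \<Rightarrow> 'v \<Rightarrow> 'v \<Rightarrow> 'a \<Rightarrow> ('v \<Rightarrow> 'a::field) \<Rightarrow> ('v::finite, 'a) mpoly"
  where "tangent_form a b c s p = wedge_form a c p + mpoly_scale (- (2 * s)) (wedge_form a b p)"

lemma mpoly_eval_wedge_form: "mpoly_eval (wedge_form a b p) q = wedge a b p q"
  by (simp add: wedge_form_def mpoly_eval_linear_form wedge_def left_diff_distrib sum_subtractf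
      of_bool_def if_distrib[of "\<lambda>t. _ * t"] if_distrib[of "\<lambda>t. t * _"] cong: if_cong)

lemma mpoly_eval_tangent_form: "mpoly_eval (tangent_form a b c s p) q = tangent a b c s p q"
  unfolding tangent_form_def tangent_def mpoly_eval_add mpoly_eval_scale mpoly_eval_wedge_form
  by simp

lemma homogeneous_wedge_form: "homogeneous 1 (wedge_form a b p)"
  unfolding wedge_form_def by (rule homogeneous_linear_form)

lemma homogeneous_tangent_form: "homogeneous 1 (tangent_form a b c s p)"
  using homogeneous_wedge_form unfolding tangent_form_def homogeneous_iff_graded
  by (intro graded_add graded_scale)

text \<open>The permanent is the polarization of a product of tangent forms; the wedges allow
  products of linear forms to separate the points. Multiplying them leaves one polynomial to keep
  nonzero.\<close>

definition genericity :: "'v \<Rightarrow> 'v \<Rightarrow> 'v \<Rightarrow> ('d::finite \<Rightarrow> 'a::field) \<Rightarrow> ('d \<Rightarrow> 'v \<Rightarrow> 'a) \<Rightarrow> 'a"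
  where "genericity a b c s p = permanent (\<lambda>i j. tangent a b c (s i) (p i) (p j)) *
    (\<Prod>i\<in>UNIV. \<Prod>j\<in>-{i}. wedge a b (p i) (p j))"

text \<open>The cone polynomials lie in the space cut out of the forms by \<open>d\<close>
  evaluations and then by the polarization; nonvanishing \<open>genericity\<close> supplies a form
  witnessing each drop in dimension.\<close>

lemma cone_space_dim_le:
  fixes P :: "'d::finite \<Rightarrow> ('a::field_char_0 ^ 'v::finite) set"
  assumes odd: "odd CARD('d)" and card: "CARD('d) > 1" and v: "\<And>i. v i \<in> P i"
    and gen: "genericity a b c s (\<lambda>i j. v i $ j) \<noteq> 0"
  shows "mpoly.dim (cone_space P) + CARD('d) + 1 \<le> (CARD('v) + CARD('d) - 1) choose CARD('d)"
proof -
  define w where "w = (\<lambda>i j. v i $ j)"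
  define H :: "('v, 'a) mpoly set" where "H = {f. homogeneous CARD('d) f}"
  define K where "K = {f \<in> H. \<forall>i\<in>UNIV. mpoly_eval f (w i) = 0}"
  define K' where "K' = {f \<in> K. polarization v f = 0}"
  have per: "permanent (\<lambda>i j. tangent a b c (s i) (w i) (w j)) \<noteq> 0"
    using gen unfolding genericity_def w_def by simp
  have wedge: "wedge a b (w i) (w j) \<noteq> 0" if "j \<noteq> i" for i j
    using gen that unfolding genericity_def w_def by auto
  have H: "mpoly.subspace H"
    unfolding H_def by (rule homogeneous_subspace)
  obtain B :: "('v, 'a) mpoly set" where B: "finite B" "H \<subseteq> mpoly.span B"
    and card_B: "card B \<le> (CARD('v) + CARD('d) - 1) choose CARD('d)"
    using homogeneous_dim[of "CARD('d)"] unfolding H_def by blast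
  have hom_prod: "(\<Prod>i\<in>UNIV. L i) \<in> H" if "\<And>i. homogeneous 1 (L i)" for L :: "'d \<Rightarrow> ('v, 'a) mpoly"
    using graded_prod[of UNIV UNIV "\<lambda>_. 1" L] that by (simp add: H_def homogeneous_iff_graded)

  have "\<exists>k. k \<noteq> i" for i :: 'd
  proof (rule ccontr)
    assume "\<nexists>k. k \<noteq> i"
    then have "(UNIV :: 'd set) = {i}" by auto
    then have "CARD('d) = 1" by (metis card_1_singleton_iff One_nat_def)
    then show False using card by simp
  qed
  then obtain k :: "'d \<Rightarrow> 'd" where k: "\<And>i. k i \<noteq> i"
    by metis
  \<comment> \<open>The factor with index \<open>j\<close> kills \<open>w j\<close>, except for
    \<open>j = i\<close>, where a second copy of the form of \<open>k i\<close> keeps the degree at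
    \<open>d\<close> without vanishing at \<open>w i\<close>.\<close>
  define f where "f i = (\<Prod>j\<in>UNIV. wedge_form a b (w (if j = i then k i else j)))" for i
  have "mpoly.dim {f \<in> H. \<forall>i\<in>UNIV. mpoly_eval f (w i) = 0} + CARD('d) \<le> mpoly.dim H"
  proof (rule mpoly.dim_common_kernel[OF H B, where w = f])
    show "f i \<in> H" for i
      unfolding f_def by (rule hom_prod) (rule homogeneous_wedge_form)
    show "mpoly_eval (f i) (w i) \<noteq> 0" for i
      using k[of i] k[of i, symmetric] by (auto simp: f_def mpoly_eval_prod mpoly_eval_wedge_form intro!: wedge)
    show "mpoly_eval (f i) (w j) = 0" if "i \<noteq> j" for i j
      unfolding f_def mpoly_eval_prod using that
      by (intro prod_zero bexI[of _ j]) (auto simp: mpoly_eval_wedge_form wedge_def)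
  qed (auto simp: mpoly_eval_add mpoly_eval_scale)
  then have dim_K: "mpoly.dim K + CARD('d) \<le> mpoly.dim H"
    unfolding K_def .

  have K: "mpoly.subspace K"
    using H unfolding K_def mpoly.subspace_def by (simp add: mpoly_eval_add mpoly_eval_scale)
  have K_span: "K \<subseteq> mpoly.span B"
    using B(2) unfolding K_def by blast
  \<comment> \<open>Its \<open>i\<close>-th factor vanishes at \<open>w i\<close>, so
    \<open>g\<close> passes all evaluations, while its polarization is the permanent in
    \<open>genericity\<close>.\<close>
  define g where "g = (\<Prod>i\<in>UNIV. tangent_form a b c (s i) (w i))"
  have "mpoly.dim {f \<in> K. polarization v f = 0} + 1 \<le> mpoly.dim K"
  proof (rule mpoly.dim_kernel_less[OF K B(1) K_span, where w = g])
    have "mpoly_eval g (w i) = 0" for i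
      unfolding g_def mpoly_eval_prod
      by (intro prod_zero bexI[of _ i]) (auto simp: mpoly_eval_tangent_form tangent_def wedge_def)
    moreover have "g \<in> H"
      unfolding g_def by (rule hom_prod) (rule homogeneous_tangent_form)
    ultimately show "g \<in> K"
      by (simp add: K_def)
    show "polarization v g \<noteq> 0"
      using per unfolding g_def polarization_prod_linear[OF homogeneous_tangent_form]
      by (simp add: mpoly_eval_tangent_form w_def)
  qed (auto simp: polarization_add polarization_scale)
  then have dim_K': "mpoly.dim K' + 1 \<le> mpoly.dim K"
    unfolding K'_def .

  have K': "mpoly.subspace K'"
  proof -
    have "polarization v 0 = 0"
      by (simp add: polarization_def)
    then show ?thesis
      using K unfolding K'_def mpoly.subspace_def by (simp add: polarization_add polarization_scale)
  qed
  have "cone_polynomials P \<subseteq> K'"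
    using cone_polynomial_conditions[where P = P and v = v, OF odd v]
    unfolding K'_def K_def H_def w_def by blast
  then have cone: "cone_space P \<subseteq> K'"
    unfolding cone_space_def by (rule mpoly.span_minimal[OF _ K'])
  \<comment> \<open>A finite basis of \<open>K'\<close> turns the inclusion \<open>cone\<close> into
    an inequality of dimensions.\<close>
  obtain A where A: "A \<subseteq> K'" "mpoly.independent A" "K' \<subseteq> mpoly.span A" "card A = mpoly.dim K'"
    by (rule mpoly.basis_exists)
  have "A \<subseteq> mpoly.span B"
    using A(1) K_span unfolding K'_def by blast
  then have "finite A"
    using mpoly.independent_span_bound[OF B(1) A(2)] by simp
  then have "mpoly.dim (cone_space P) \<le> mpoly.dim K'"
    using mpoly.dim_le_card[OF subset_trans[OF cone A(3)]] A(4) by simp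
  moreover have "mpoly.dim H \<le> card B"
    using mpoly.dim_le_card[OF B(2,1)] .
  ultimately show ?thesis
    using dim_K dim_K' card_B by linarith
qed

section \<open>Genericity is an open nonempty condition\<close>

text \<open>Stated for functions of the points, so that multihomogeneity can be read off a formula
  without writing out the polynomial. The multidegree \<open>k\<close> is explicit because sums
  require equal multidegrees.\<close>

definition multiform :: "('d::finite \<Rightarrow> nat) \<Rightarrow> (('d \<Rightarrow> 'v::finite \<Rightarrow> 'a::field) \<Rightarrow> 'a) \<Rightarrow> bool"
  where "multiform k F \<longleftrightarrow> (\<exists>f. (\<forall>i. graded ({i} \<times> UNIV) (k i) f) \<and>
    (\<forall>p. mpoly_eval f (\<lambda>(i, j). p i j) = F p))"

lemma multiform_var:
  fixes i :: "'d::finite" and a :: "'v::finite"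
  shows "multiform (\<lambda>k. of_bool (k = i)) (\<lambda>p. p i a :: 'a::field)"
proof -
  define f :: "('d \<times> 'v, 'a) mpoly"
    where "f = Poly_Mapping.single (Poly_Mapping.single (i, a) 1) 1"
  have "(\<Sum>x\<in>{k} \<times> UNIV. Poly_Mapping.lookup (Poly_Mapping.single (i, a) 1) x) = of_bool (k = i)" for k
    by (auto simp: lookup_single when_def)
  then have "graded ({k} \<times> UNIV) (of_bool (k = i)) f" for k
    unfolding f_def by (rule graded_single)
  moreover have "mpoly_eval f (\<lambda>(i, j). p i j) = p i a" for p
    unfolding f_def mpoly_eval_var by simp
  ultimately show ?thesis
    unfolding multiform_def by blast
qed

lemma multiform_const: "multiform (\<lambda>k. 0) (\<lambda>p. c)"
  unfolding multiform_def
  by (intro exI[of _ "Poly_Mapping.single 0 c"]) (simp add: graded_single mpoly_eval_single)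

lemma multiform_mult:
  assumes "multiform k F" "multiform l G"
  shows "multiform (\<lambda>i. k i + l i) (\<lambda>p. F p * G p)"
proof -
  obtain f g where "\<And>i. graded ({i} \<times> UNIV) (k i) f" "\<And>i. graded ({i} \<times> UNIV) (l i) g"
    "\<And>p. mpoly_eval f (\<lambda>(i, j). p i j) = F p" "\<And>p. mpoly_eval g (\<lambda>(i, j). p i j) = G p"
    using assms unfolding multiform_def by blast
  then show ?thesis
    unfolding multiform_def by (intro exI[of _ "f * g"]) (simp add: graded_mult mpoly_eval_mult)
qed

lemma multiform_add:
  assumes "multiform k F" "multiform k G"
  shows "multiform k (\<lambda>p. F p + G p)"
proof -
  obtain f g where "\<And>i. graded ({i} \<times> UNIV) (k i) f" "\<And>i. graded ({i} \<times> UNIV) (k i) g"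
    "\<And>p. mpoly_eval f (\<lambda>(i, j). p i j) = F p" "\<And>p. mpoly_eval g (\<lambda>(i, j). p i j) = G p"
    using assms unfolding multiform_def by blast
  then show ?thesis
    unfolding multiform_def by (intro exI[of _ "f + g"]) (simp add: graded_add mpoly_eval_add)
qed

lemma multiform_scale: "multiform k F \<Longrightarrow> multiform k (\<lambda>p. c * F p)"
  using multiform_mult[OF multiform_const] by fastforce

lemma multiform_diff: "multiform k F \<Longrightarrow> multiform k G \<Longrightarrow> multiform k (\<lambda>p. F p - G p)"
  using multiform_add[OF _ multiform_scale, of k F G "- 1"] by simp

lemma multiform_sum:
  assumes "finite S" "S \<noteq> {}" "\<And>s. s \<in> S \<Longrightarrow> multiform k (F s)"
  shows "multiform k (\<lambda>p. \<Sum>s\<in>S. F s p)"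
  using assms by (induction S rule: finite_ne_induct) (simp_all add: multiform_add)

lemma multiform_prod:
  assumes "\<And>s. s \<in> S \<Longrightarrow> multiform (k s) (F s)"
  shows "multiform (\<lambda>i. \<Sum>s\<in>S. k s i) (\<lambda>p. \<Prod>s\<in>S. F s p)"
  using assms
  by (induction S rule: infinite_finite_induct) (simp_all add: multiform_const multiform_mult)

lemma multiform_wedge:
  "multiform (\<lambda>k. of_bool (k = i) + of_bool (k = j)) (\<lambda>p. wedge a b (p i) (p j))"
  unfolding wedge_def by (intro multiform_diff multiform_mult multiform_var)

lemma multiform_tangent:
  "multiform (\<lambda>k. of_bool (k = i) + of_bool (k = j)) (\<lambda>p. tangent a b c s (p i) (p j))"
  unfolding tangent_def by (intro multiform_diff multiform_scale multiform_wedge)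

text \<open>In the term of a permutation \<open>q\<close> every point occurs once as
  \<open>p i\<close> and once as \<open>p (q i)\<close>, so all terms of the permanent have degree 2
  in each point.\<close>

lemma multiform_genericity:
  fixes s :: "'d::finite \<Rightarrow> 'a::field" and a b c :: "'v::finite"
  shows "\<exists>k. multiform k (genericity a b c s)"
proof -
  let ?T = "\<lambda>(q :: 'd \<Rightarrow> 'd) (p :: 'd \<Rightarrow> 'v \<Rightarrow> 'a). \<Prod>i\<in>UNIV. tangent a b c (s i) (p i) (p (q i))"
  have "multiform (\<lambda>k. 2) (?T q)" if "bij q" for q
  proof -
    have "(\<Sum>i\<in>UNIV. of_bool (k = i) + of_bool (k = q i)) = (2 :: nat)" for k
    proof -
      have "(\<Sum>i\<in>UNIV. of_bool (k = q i)) = (\<Sum>i\<in>UNIV. of_bool (k = i) :: nat)"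
        by (rule sum.reindex_bij_betw[OF that])
      then show ?thesis
        by (simp add: sum.distrib of_bool_def)
    qed
    then have "(\<lambda>k. \<Sum>i\<in>UNIV. of_bool (k = i) + of_bool (k = q i)) = (\<lambda>k. 2 :: nat)"
      by blast
    moreover have "multiform (\<lambda>k. \<Sum>i\<in>UNIV. of_bool (k = i) + of_bool (k = q i)) (?T q)"
      by (rule multiform_prod) (rule multiform_tangent)
    ultimately show ?thesis
      by (simp only:)
  qed
  then have "multiform (\<lambda>k. 2) (\<lambda>p. permanent (\<lambda>i j. tangent a b c (s i) (p i) (p j)))"
    unfolding permanent_def by (intro multiform_sum) auto
  moreover have "multiform (\<lambda>k. \<Sum>i\<in>UNIV. \<Sum>j\<in>-{i}. of_bool (k = i) + of_bool (k = j))
      (\<lambda>p :: 'd \<Rightarrow> 'v \<Rightarrow> 'a. \<Prod>i\<in>UNIV. \<Prod>j\<in>-{i}. wedge a b (p i) (p j))"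
    by (intro multiform_prod multiform_wedge)
  ultimately show ?thesis
    unfolding genericity_def by (intro exI) (rule multiform_mult)
qed

text \<open>\<open>vanishes_at\<close> ranges over all nonzero representatives, so its negation is
  the existence of one good choice \<open>v\<close>.\<close>

lemma zariski_open_multiform:
  assumes "multiform k F"
  shows "zariski_open {P \<in> tuples. \<exists>v. (\<forall>i. v i \<in> P i - {0}) \<and> F (\<lambda>i j. v i $ j) \<noteq> 0}"
proof -
  obtain f where f: "\<And>i. graded ({i} \<times> UNIV) (k i) f" "\<And>p. mpoly_eval f (\<lambda>(i, j). p i j) = F p"
    using assms unfolding multiform_def by blast
  have "(\<Sum>j\<in>UNIV. Poly_Mapping.lookup m (i, j)) = k i" if "m \<in> Poly_Mapping.keys f" for m i
    using f(1)[of i] that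
    by (auto simp: graded_def sum.cartesian_product' dest!: bspec[OF _ that])
  then have "multihomogeneous f"
    unfolding multihomogeneous_def by blast
  then show ?thesis
    unfolding zariski_open_def zariski_closed_def
    by (intro conjI exI[of _ "{f}"]) (auto simp: vanishes_at_def f(2))
qed

text \<open>Number the indices and shift cyclically. The shift will select a product of off-diagonal
  entries in a permanent with zero diagonal.\<close>

lemma cyclic_derangement:
  assumes "CARD('d::finite) > 1"
  obtains q :: "'d::finite \<Rightarrow> 'd" where "bij q" "\<And>i. q i \<noteq> i"
proof -
  let ?n = "CARD('d)"
  obtain t :: "'d \<Rightarrow> nat" where t: "bij_betw t UNIV {0..<?n}"
    using ex_bij_betw_finite_nat[of "UNIV :: 'd set"] by auto
  define q where "q i = inv_into UNIV t (Suc (t i) mod ?n)" for i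
  have lt: "t i < ?n" for i
    using t by (auto simp: bij_betw_def)
  have t_q: "t (q i) = Suc (t i) mod ?n" for i
    unfolding q_def using t assms by (intro f_inv_into_f) (auto simp: bij_betw_def)
  have inj_t: "t i = t j \<longleftrightarrow> i = j" for i j
    using t by (auto simp: bij_betw_def inj_on_def)
  have "inj q"
  proof (rule injI)
    fix i j assume "q i = q j"
    then have "Suc (t i) mod ?n = Suc (t j) mod ?n"
      by (metis t_q)
    then have "t i = t j"
      using lt[of i] lt[of j] by (auto simp: mod_Suc split: if_splits)
    then show "i = j"
      by (simp add: inj_t)
  qed
  moreover have "q i \<noteq> i" for i
  proof
    assume "q i = i"
    then have "Suc (t i) mod ?n = t i"
      by (metis t_q)
    then show False
      using lt[of i] assms by (auto simp: mod_Suc split: if_splits)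
  qed
  ultimately show thesis
    by (intro that[of q]) (auto simp: bij_def finite_UNIV_inj_surj)
qed

text \<open>Points on a conic: each tangent line has all the other points on its positive side, so the
  permanent is a sum of nonnegative integers.\<close>

lemma genericity_witness:
  fixes a b c :: "'v::finite"
  assumes card: "CARD('d::finite) > 1" and abc: "a \<noteq> b" "a \<noteq> c" "b \<noteq> c"
  obtains s and v :: "'d::finite \<Rightarrow> 'a::field_char_0 ^ 'v"
  where "\<And>i. v i \<noteq> 0" "genericity a b c s (\<lambda>i j. v i $ j) \<noteq> 0"
proof -
  obtain t' :: "'d \<Rightarrow> nat" where "inj t'"
    using finite_imp_inj_to_nat_seg[of "UNIV :: 'd set"] by auto
  \<comment> \<open>Integer parameters let positivity be argued in \<open>int\<close>;
    \<open>of_int\<close> is injective in characteristic zero.\<close>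
  define t where "t i = int (t' i)" for i
  have t: "t i = t j \<longleftrightarrow> i = j" for i j
    using \<open>inj t'\<close> by (auto simp: t_def inj_def)
  define s where "s i = (of_int (t i) :: 'a)" for i
  define v :: "'d \<Rightarrow> 'a ^ 'v" where
    "v i = (\<chi> j. if j = a then 1 else if j = b then s i else if j = c then (s i)\<^sup>2 else 0)" for i
  have v: "v i $ a = 1" "v i $ b = s i" "v i $ c = (s i)\<^sup>2" for i
    using abc by (auto simp: v_def)
  \<comment> \<open>A tangent line meets the conic doubly at its point of contact, hence the
    square.\<close>
  have tangent: "tangent a b c (s i) (\<lambda>k. v i $ k) (\<lambda>k. v j $ k) = of_int ((t j - t i)\<^sup>2)" for i j
    by (simp add: tangent_def wedge_def v s_def power2_eq_square algebra_simps)
  have wedge: "wedge a b (\<lambda>k. v i $ k) (\<lambda>k. v j $ k) = of_int (t j - t i)" for i j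
    by (simp add: wedge_def v s_def)
  obtain q :: "'d \<Rightarrow> 'd" where q: "bij q" "\<And>i. q i \<noteq> i"
    using cyclic_derangement[OF card] by blast
  have "0 < (\<Prod>i\<in>UNIV. (t (q i) - t i)\<^sup>2)"
    using q(2) t by (intro prod_pos) auto
  \<comment> \<open>All terms are nonnegative, so the single term of the derangement bounds the sum
    from below.\<close>
  also have "\<dots> \<le> permanent (\<lambda>i j. (t j - t i)\<^sup>2)"
    unfolding permanent_def
    by (rule member_le_sum[where f = "\<lambda>q. \<Prod>i\<in>UNIV. (t (q i) - t i)\<^sup>2"])
      (use q(1) in \<open>auto intro: prod_nonneg\<close>)
  finally have "(of_int (permanent (\<lambda>i j. (t j - t i)\<^sup>2)) :: 'a) \<noteq> 0"
    by simp
  moreover have "permanent (\<lambda>i j. tangent a b c (s i) (\<lambda>k. v i $ k) (\<lambda>k. v j $ k)) =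
      of_int (permanent (\<lambda>i j. (t j - t i)\<^sup>2))"
    unfolding tangent permanent_def by (simp only: of_int_sum of_int_prod)
  moreover have "(\<Prod>i\<in>UNIV. \<Prod>j\<in>-{i}. wedge a b (\<lambda>k. v i $ k) (\<lambda>k. v j $ k)) \<noteq> 0"
    unfolding wedge using t by simp
  ultimately have "genericity a b c s (\<lambda>i j. v i $ j) \<noteq> 0"
    unfolding genericity_def by simp
  moreover have "v i \<noteq> 0" for i
    using v(1)[of i] by (metis zero_index zero_neq_one)
  ultimately show thesis
    by (rule that[rotated])
qed

section \<open>The bound on a nonempty open set of point tuples\<close>

theorem theorem2p3:
  fixes n d :: nat
  assumes "n \<ge> 2" and "d \<ge> 3" and "odd d"
    and "CARD('v::finite) = n + 1" and "CARD('d::finite) = d"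
  shows "\<exists>U :: ('d \<Rightarrow> ('a::field_char_0 ^ 'v) set) set. zariski_open U \<and> U \<noteq> {} \<and>
    (\<forall>P\<in>U. int (mpoly.dim (cone_space P)) \<le> int ((d + n) choose n) - int d - 1)"
proof -
  have card: "CARD('d) > 1" and odd: "odd CARD('d)"
    using assms by simp_all
  have "3 \<le> CARD('v)"
    using assms by simp
  \<comment> \<open>Since \<open>n \<ge> 2\<close> there are three distinct coordinates, enough to
    hold a plane conic.\<close>
  then obtain S :: "'v set" where "card S = 3"
    using obtain_subset_with_card_n by metis
  then obtain a b c :: 'v where abc: "a \<noteq> b" "a \<noteq> c" "b \<noteq> c"
    by (auto simp: card_3_iff)
  obtain s and v :: "'d \<Rightarrow> 'a ^ 'v" where v: "\<And>i. v i \<noteq> 0"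
    and gen: "genericity a b c s (\<lambda>i j. v i $ j) \<noteq> 0"
    using genericity_witness[OF card abc] by metis
  \<comment> \<open>The parameters \<open>s\<close> stay those of the witness, so a single
    polynomial in the points defines \<open>U\<close>.\<close>
  define U :: "('d \<Rightarrow> ('a ^ 'v) set) set" where
    "U = {P \<in> tuples. \<exists>v. (\<forall>i. v i \<in> P i - {0}) \<and> genericity a b c s (\<lambda>i j. v i $ j) \<noteq> 0}"
  show ?thesis
  proof (intro exI conjI ballI)
    obtain k where "multiform k (genericity a b c s :: ('d \<Rightarrow> 'v \<Rightarrow> 'a) \<Rightarrow> 'a)"
      using multiform_genericity by metis
    then show "zariski_open U"
      unfolding U_def by (rule zariski_open_multiform)
    have "vec.dim (vec.span {v i}) = 1" for i
      using v[of i] by (simp add: vec.dim_span_eq_card_independent del: vec.dim_span)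
    then have "(\<lambda>i. vec.span {v i}) \<in> U"
      using v gen by (auto simp: U_def tuples_def projective_space_def
          intro!: exI[of _ v] vec.span_base)
    then show "U \<noteq> {}"
      by blast
    fix P assume "P \<in> U"
    then obtain v where v: "\<And>i. v i \<in> P i" and "genericity a b c s (\<lambda>i j. v i $ j) \<noteq> 0"
      unfolding U_def by blast
    then have "mpoly.dim (cone_space P) + d + 1 \<le> (n + d) choose d"
      using cone_space_dim_le[where P = P and v = v, OF odd card v] assms(4,5) by simp
    also have "\<dots> = (d + n) choose n"
      using binomial_symmetric[of d "n + d"] by (simp add: add.commute)
    finally show "int (mpoly.dim (cone_space P)) \<le> int ((d + n) choose n) - int d - 1"
      by linarith
  qed
qed

end
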